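(* Let $L$ be a dcpo satisfying the following two conditions: (1) $L$ with its Scott topology is co-sober; (2) for each $x\in L$, there exists a directed subset $D$ of $L$ such that $x=\sup D$ and, for each $d\in D$, the set ${\uparrow}d\setminus\{d\}$ is compact in the Scott topology of $L$. Then $L$ is a $\mathcal Q_{\sigma}$-unique dcpo; that is, for every dcpo $M$, if $(\mathcal Q(L),\supseteq)$ and $(\mathcal Q(M),\supseteq)$ are order isomorphic, then $L$ and $M$ are order isomorphic.
   Context: For a poset $P$ and $A\subseteq P$, ${\uparrow}A=\{x\in P: x\ge a \text{ for some } a\in A\}$ and ${\uparrow}x={\uparrow}\{x\}$; $A$ is an upper set if $A={\uparrow}A$. A subset $D\subseteq P$ is directed if every finite subset of $D$ (including the empty one) has an upper bound in $D$. A dcpo is a poset in which every directed subset has a supremum. A subset $U\subseteq P$ is Scott open if $U={\uparrow}U$ and for every directed $D\subseteq P$ whose supremum exists, $\sup D\in U$ implies $D\cap U\ne\emptyset$; the Scott open sets form the Scott topology. $\mathcal Q(P)$ denotes the set of all compact saturated subsets of $P$ with respect to the Scott topology (saturated means upper set; compact means every open cover has a finite subcover; the empty set is included), ordered by reverse inclusion. A nonempty compact saturated subset $K$ of a space is $k$-irreducible if it cannot be written as the union of two proper compact saturated subsets (i.e. two compact saturated sets each properly contained in $K$). A space is co-sober if every $k$-irreducible compact saturated subset is the saturation of a point; for the Scott topology on $P$ this means it equals ${\uparrow}x$ for some $x\in P$. *)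

theory Defs
  imports "HOL-Algebra.Order" "HOL-Analysis.Abstract_Topology"
begin

text \<open>Posets are HOL-Algebra orders satisfying \<^locale>\<open>partial_order\<close>; the carrier may be empty.\<close>

definition up_closure :: "('a, 'c) gorder_scheme \<Rightarrow> 'a set \<Rightarrow> 'a set" where
  "up_closure P A = {x \<in> carrier P. \<exists>a\<in>A. a \<sqsubseteq>\<^bsub>P\<^esub> x}"

definition upper_set :: "('a, 'c) gorder_scheme \<Rightarrow> 'a set \<Rightarrow> bool" where
  "upper_set P A \<longleftrightarrow> A \<subseteq> carrier P \<and> A = up_closure P A"

text \<open>Taking \<open>F = {}\<close> shows that directed sets are nonempty.\<close>

definition directed :: "('a, 'c) gorder_scheme \<Rightarrow> 'a set \<Rightarrow> bool" where
  "directed P D \<longleftrightarrow> D \<subseteq> carrier P \<and> (\<forall>F. finite F \<and> F \<subseteq> D \<longrightarrow> (\<exists>u\<in>D. u \<in> Upper P F))"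

locale dcpo = partial_order +
  assumes directed_has_sup: "directed L D \<Longrightarrow> \<exists>s. is_lub L s D"

definition scott_open :: "('a, 'c) gorder_scheme \<Rightarrow> 'a set \<Rightarrow> bool" where
  "scott_open P U \<longleftrightarrow>
     upper_set P U \<and>
     (\<forall>D s. directed P D \<and> is_lub P s D \<and> s \<in> U \<longrightarrow> D \<inter> U \<noteq> {})"

definition scott_topology :: "('a, 'c) gorder_scheme \<Rightarrow> 'a topology" where
  "scott_topology P = topology (scott_open P)"

context
  fixes P :: "('a, 'c) gorder_scheme"
  assumes po: "partial_order P"
begin

lemma upper_set_iff:
  "upper_set P A \<longleftrightarrow> A \<subseteq> carrier P \<and> (\<forall>x\<in>A. \<forall>y\<in>carrier P. x \<sqsubseteq>\<^bsub>P\<^esub> y \<longrightarrow> y \<in> A)"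
proof -
  have refl: "x \<sqsubseteq>\<^bsub>P\<^esub> x" if "x \<in> carrier P" for x
    using that po by (simp add: partial_order_def weak_partial_order.le_refl)
  have *: "A \<subseteq> up_closure P A" if "A \<subseteq> carrier P"
    using that refl unfolding up_closure_def subset_iff mem_Collect_eq by meson
  show ?thesis
  proof
    assume "upper_set P A"
    then have A: "A \<subseteq> carrier P" "up_closure P A = A"
      by (simp_all add: upper_set_def)
    have "y \<in> up_closure P A" if "x \<in> A" "y \<in> carrier P" "x \<sqsubseteq>\<^bsub>P\<^esub> y" for x y
      using that by (auto simp: up_closure_def)
    with A show "A \<subseteq> carrier P \<and> (\<forall>x\<in>A. \<forall>y\<in>carrier P. x \<sqsubseteq>\<^bsub>P\<^esub> y \<longrightarrow> y \<in> A)"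
      by simp
  next
    assume A: "A \<subseteq> carrier P \<and> (\<forall>x\<in>A. \<forall>y\<in>carrier P. x \<sqsubseteq>\<^bsub>P\<^esub> y \<longrightarrow> y \<in> A)"
    then have "up_closure P A \<subseteq> A"
      by (auto simp: up_closure_def)
    with * A show "upper_set P A"
      unfolding upper_set_def by (meson subset_antisym)
  qed
qed

lemma istopology_scott_open: "istopology (scott_open P)"
  unfolding istopology_def
proof (intro conjI allI impI)
  fix U V assume U: "scott_open P U" and V: "scott_open P V"
  have u: "upper_set P U" "upper_set P V"
    using U V by (simp_all add: scott_open_def)
  have "D \<inter> (U \<inter> V) \<noteq> {}" if D: "directed P D" "is_lub P s D" "s \<in> U \<inter> V" for D s
  proof -
    have "D \<inter> U \<noteq> {}" "D \<inter> V \<noteq> {}"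
      using U V D unfolding scott_open_def by (meson IntD1, meson IntD2)
    then obtain a b where ab: "a \<in> D" "a \<in> U" "b \<in> D" "b \<in> V" by blast
    have "finite {a, b} \<and> {a, b} \<subseteq> D" using ab by simp
    then obtain c where c: "c \<in> D" "c \<in> Upper P {a, b}"
      using D(1) unfolding directed_def by meson
    have "a \<in> carrier P" "b \<in> carrier P"
      using ab u by (auto simp only: upper_set_iff)
    then have "a \<sqsubseteq>\<^bsub>P\<^esub> c" "b \<sqsubseteq>\<^bsub>P\<^esub> c" "c \<in> carrier P"
      using c(2) by (simp_all add: Upper_def)
    then have "c \<in> U" "c \<in> V"
      using u ab unfolding upper_set_iff by meson+
    with c(1) show ?thesis by blast
  qed
  moreover have "upper_set P (U \<inter> V)"
    using u unfolding upper_set_iff by blast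
  ultimately show "scott_open P (U \<inter> V)"
    unfolding scott_open_def by meson
next
  fix \<K> assume K: "\<forall>K\<in>\<K>. scott_open P K"
  have "\<forall>K\<in>\<K>. upper_set P K"
    using K by (simp add: scott_open_def)
  then have "upper_set P (\<Union>\<K>)"
    unfolding upper_set_iff by blast
  moreover have "D \<inter> \<Union>\<K> \<noteq> {}" if D: "directed P D" "is_lub P s D" "s \<in> \<Union>\<K>" for D s
  proof -
    obtain U where U: "U \<in> \<K>" "s \<in> U" using D(3) by blast
    then have "scott_open P U" using K by simp
    then have "D \<inter> U \<noteq> {}"
      using D(1,2) U(2) unfolding scott_open_def by meson
    with U(1) show ?thesis by blast
  qed
  ultimately show "scott_open P (\<Union>\<K>)"
    unfolding scott_open_def by meson
qed

lemma openin_scott_topology: "openin (scott_topology P) = scott_open P"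
  unfolding scott_topology_def by (rule topology_inverse'[OF istopology_scott_open])

lemma topspace_scott_topology: "topspace (scott_topology P) = carrier P"
proof -
  have "D \<inter> carrier P \<noteq> {}" if D: "directed P D" for D
  proof -
    have "finite {} \<and> {} \<subseteq> D" by simp
    then have "\<exists>u\<in>D. u \<in> Upper P {}"
      using D unfolding directed_def by meson
    moreover have "D \<subseteq> carrier P" using D unfolding directed_def by meson
    ultimately show ?thesis by blast
  qed
  moreover have "upper_set P (carrier P)"
    by (simp add: upper_set_iff)
  ultimately have "scott_open P (carrier P)"
    unfolding scott_open_def by meson
  moreover have "U \<subseteq> carrier P" if "scott_open P U" for U
    using that unfolding scott_open_def upper_set_iff by meson
  ultimately show ?thesis
    unfolding topspace_def openin_scott_topology by blast
qed

end

definition compact_saturated :: "('a, 'c) gorder_scheme \<Rightarrow> 'a set \<Rightarrow> bool" where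
  "compact_saturated P K \<longleftrightarrow> upper_set P K \<and> compactin (scott_topology P) K"

definition Q_poset :: "('a, 'c) gorder_scheme \<Rightarrow> 'a set gorder" where
  "Q_poset P = \<lparr>carrier = {K. compact_saturated P K}, eq = (=), le = (\<supseteq>)\<rparr>"

lemma partial_order_Q_poset: "partial_order (Q_poset P)"
  unfolding Q_poset_def by unfold_locales simp_all

definition k_irreducible :: "('a, 'c) gorder_scheme \<Rightarrow> 'a set \<Rightarrow> bool" where
  "k_irreducible P K \<longleftrightarrow>
     compact_saturated P K \<and> K \<noteq> {} \<and>
     (\<nexists>A B. compact_saturated P A \<and> compact_saturated P B \<and> A \<subset> K \<and> B \<subset> K \<and> K = A \<union> B)"

definition co_sober :: "('a, 'c) gorder_scheme \<Rightarrow> bool" where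
  "co_sober P \<longleftrightarrow> (\<forall>K. k_irreducible P K \<longrightarrow> (\<exists>x\<in>carrier P. K = up_closure P {x}))"

definition order_isomorphic ::
    "('a, 'c) gorder_scheme \<Rightarrow> ('b, 'd) gorder_scheme \<Rightarrow> bool" where
  "order_isomorphic P Q \<longleftrightarrow> (\<exists>f. order_emb P Q f \<and> bij_betw f (carrier P) (carrier Q))"

end

theory Submission
  imports Defs
begin

text \<open>
  A point can be traced in the poset of compact saturated sets through its principal filter.
  Finite unions of compact saturated sets are compact saturated, so \<open>k\<close>-irreducibility is a property of the order
  (join-irreducibility with respect to inclusion), and every principal filter \<open>\<up>y\<close> is
  \<open>k\<close>-irreducible. An isomorphism \<open>f\<close> from the compact saturated sets of \<open>L\<close> to those of \<open>M\<close> thus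
  carries \<open>k\<close>-irreducible sets to \<open>k\<close>-irreducible sets in both directions, and since \<open>L\<close> is co-sober,
  each \<open>\<up>y\<close> with \<open>y \<in> M\<close> is \<open>f (\<up>x)\<close> for some \<open>x \<in> L\<close> (\<open>principal_preimage\<close>).

  As \<open>M\<close> need not be co-sober, the converse, that \<open>f (\<up>x)\<close> is always principal, must come from
  the compactness of punctured principal filters. If \<open>\<up>d - {d}\<close> is compact, it is the largest
  compact saturated set properly inside \<open>\<up>d\<close>. Then \<open>f (\<up>d)\<close> also has a largest compact saturated proper subset, and any point
  of \<open>f (\<up>d)\<close> outside that subset generates \<open>f (\<up>d)\<close> (\<open>principal_image_of_punctured_compact\<close>). Every
  point \<open>x\<close> is a directed supremum of such points \<open>d\<close>. The generators of the sets \<open>f (\<up>d)\<close> form a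
  directed set in \<open>M\<close>, whose supremum generates \<open>f (\<up>x)\<close> (\<open>principal_image_of_directed_sup\<close>).
  Matching generators gives the order isomorphism between \<open>L\<close> and \<open>M\<close>.
\<close>

section \<open>Principal filters in the Scott topology\<close>

lemma mem_up_closure_singleton: "x \<in> up_closure P {a} \<longleftrightarrow> x \<in> carrier P \<and> a \<sqsubseteq>\<^bsub>P\<^esub> x"
  by (auto simp: up_closure_def)

context partial_order
begin

lemma up_closure_singleton_subset_iff:
  assumes "x \<in> carrier L" "y \<in> carrier L"
  shows "up_closure L {x} \<subseteq> up_closure L {y} \<longleftrightarrow> y \<sqsubseteq> x"
  using assms le_trans by (auto simp: mem_up_closure_singleton subset_iff)

lemma up_closure_singleton_subset_upper:
  assumes "upper_set L A" "x \<in> A"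
  shows "up_closure L {x} \<subseteq> A"
  using assms unfolding upper_set_iff[OF partial_order_axioms]
  by (auto simp: mem_up_closure_singleton)

lemma self_mem_up_closure: "x \<in> carrier L \<Longrightarrow> x \<in> up_closure L {x}"
  by (simp add: mem_up_closure_singleton)

lemma upper_set_up_closure_singleton:
  assumes "x \<in> carrier L"
  shows "upper_set L (up_closure L {x})"
  using assms le_trans unfolding upper_set_iff[OF partial_order_axioms]
  by (auto simp: mem_up_closure_singleton)

text \<open>One member of an open cover contains \<open>x\<close>; being an upper set, it covers all of \<open>\<up>x\<close>.\<close>

lemma compact_saturated_up_closure_singleton:
  assumes x: "x \<in> carrier L"
  shows "compact_saturated L (up_closure L {x})"
  unfolding compact_saturated_def compactin_def openin_scott_topology[OF partial_order_axioms]
    topspace_scott_topology[OF partial_order_axioms]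
proof (intro conjI allI impI upper_set_up_closure_singleton x)
  show "up_closure L {x} \<subseteq> carrier L" by (auto simp: mem_up_closure_singleton)
next
  fix \<U> assume U: "(\<forall>U\<in>\<U>. scott_open L U) \<and> up_closure L {x} \<subseteq> \<Union>\<U>"
  then obtain V where V: "V \<in> \<U>" "x \<in> V" using self_mem_up_closure[OF x] by blast
  then have "upper_set L V" using U unfolding scott_open_def by blast
  then have "up_closure L {x} \<subseteq> \<Union>{V}"
    using up_closure_singleton_subset_upper V(2) by simp
  with V(1) show "\<exists>\<F>. finite \<F> \<and> \<F> \<subseteq> \<U> \<and> up_closure L {x} \<subseteq> \<Union>\<F>"
    by (intro exI[of _ "{V}"]) simp
qed

lemma compact_saturated_empty: "compact_saturated L {}"
  by (simp add: compact_saturated_def upper_set_iff[OF partial_order_axioms])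

lemma compact_saturated_Un:
  assumes "compact_saturated L A" "compact_saturated L B"
  shows "compact_saturated L (A \<union> B)"
proof -
  have "upper_set L (A \<union> B)"
    using assms unfolding compact_saturated_def upper_set_iff[OF partial_order_axioms] by blast
  then show ?thesis
    using assms compactin_Un by (auto simp: compact_saturated_def)
qed

text \<open>If \<open>\<up>x = A \<union> B\<close>, the part containing \<open>x\<close> is already all of \<open>\<up>x\<close>.\<close>

lemma k_irreducible_up_closure_singleton:
  assumes x: "x \<in> carrier L"
  shows "k_irreducible L (up_closure L {x})"
  unfolding k_irreducible_def
proof (intro conjI notI compact_saturated_up_closure_singleton x)
  assume "up_closure L {x} = {}"
  with self_mem_up_closure[OF x] show False by blast
next
  assume "\<exists>A B. compact_saturated L A \<and> compact_saturated L B \<and>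
    A \<subset> up_closure L {x} \<and> B \<subset> up_closure L {x} \<and> up_closure L {x} = A \<union> B"
  then obtain A B where AB: "upper_set L A" "upper_set L B"
      "A \<subset> up_closure L {x}" "B \<subset> up_closure L {x}" "up_closure L {x} = A \<union> B"
    unfolding compact_saturated_def by blast
  then show False
    using self_mem_up_closure[OF x] up_closure_singleton_subset_upper by blast
qed

lemma compact_saturated_punctured_up_closure:
  assumes d: "d \<in> carrier L"
    and cpt: "compactin (scott_topology L) (up_closure L {d} - {d})"
  shows "compact_saturated L (up_closure L {d} - {d})"
proof -
  have "upper_set L (up_closure L {d} - {d})"
    unfolding upper_set_iff[OF partial_order_axioms]
    using d le_trans le_antisym by (auto simp: mem_up_closure_singleton)
  with cpt show ?thesis by (simp add: compact_saturated_def)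
qed

lemma lub_le_iff:
  assumes "is_lub L s D" "D \<subseteq> carrier L" "z \<in> carrier L"
  shows "s \<sqsubseteq> z \<longleftrightarrow> (\<forall>d\<in>D. d \<sqsubseteq> z)"
proof -
  have s: "s \<in> carrier L" "\<And>d. d \<in> D \<Longrightarrow> d \<sqsubseteq> s"
    and least: "\<And>u. u \<in> Upper L D \<Longrightarrow> s \<sqsubseteq> u"
    using assms(1,2) by (auto simp: least_def Upper_def)
  show ?thesis
  proof
    assume "s \<sqsubseteq> z"
    then show "\<forall>d\<in>D. d \<sqsubseteq> z" using s assms(2,3) le_trans by blast
  next
    assume "\<forall>d\<in>D. d \<sqsubseteq> z"
    then show "s \<sqsubseteq> z" using least assms(3) by (simp add: Upper_def)
  qed
qed

end

section \<open>Isomorphisms between posets of compact saturated sets\<close>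

text \<open>Reversing the order on both sides does not change the isomorphisms, so these are described
  by inclusion: joins are then unions, which is what \<open>k\<close>-irreducibility speaks of.\<close>

locale Q_isomorphism =
  L: partial_order L + M: partial_order M
  for L :: "('a, 'c) gorder_scheme" and M :: "('b, 'd) gorder_scheme" +
  fixes f :: "'a set \<Rightarrow> 'b set"
  assumes bij: "bij_betw f {K. compact_saturated L K} {K. compact_saturated M K}"
    and image_subset_iff: "\<lbrakk>compact_saturated L A; compact_saturated L B\<rbrakk>
      \<Longrightarrow> f A \<subseteq> f B \<longleftrightarrow> A \<subseteq> B"
begin

lemma compact_saturated_image: "compact_saturated L A \<Longrightarrow> compact_saturated M (f A)"
  using bij_betwE[OF bij] by blast

lemma compact_saturated_preimage:
  assumes "compact_saturated M B"
  obtains A where "compact_saturated L A" "f A = B"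
  using assms bij_betw_imp_surj_on[OF bij] by (metis imageE mem_Collect_eq)

lemma image_eq_iff:
  "\<lbrakk>compact_saturated L A; compact_saturated L B\<rbrakk> \<Longrightarrow> f A = f B \<longleftrightarrow> A = B"
  using image_subset_iff by (metis subset_antisym subset_refl)

lemma image_psubset_iff:
  "\<lbrakk>compact_saturated L A; compact_saturated L B\<rbrakk> \<Longrightarrow> f A \<subset> f B \<longleftrightarrow> A \<subset> B"
  using image_subset_iff image_eq_iff by (metis psubset_eq)

lemma image_Un:
  assumes A: "compact_saturated L A" and B: "compact_saturated L B"
  shows "f (A \<union> B) = f A \<union> f B"
proof -
  note AB = L.compact_saturated_Un[OF A B]
  obtain C where C: "compact_saturated L C" "f C = f A \<union> f B"
    using compact_saturated_preimage
      M.compact_saturated_Un[OF compact_saturated_image[OF A] compact_saturated_image[OF B]]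
    by blast
  have "A \<subseteq> C" "B \<subseteq> C"
    using image_subset_iff[OF A C(1)] image_subset_iff[OF B C(1)] C(2) by auto
  then have "f (A \<union> B) \<subseteq> f A \<union> f B"
    using image_subset_iff[OF AB C(1)] C(2) by auto
  moreover have "f A \<subseteq> f (A \<union> B)" "f B \<subseteq> f (A \<union> B)"
    using image_subset_iff[OF A AB] image_subset_iff[OF B AB] by auto
  ultimately show ?thesis by blast
qed

text \<open>Being order-theoretic, a decomposition of \<open>K\<close> into two proper parts is carried by \<open>f\<close> to one
  of \<open>f K\<close>.\<close>

lemma k_irreducible_reflected:
  assumes K: "compact_saturated L K" and irr: "k_irreducible M (f K)"
  shows "k_irreducible L K"
  unfolding k_irreducible_def
proof (intro conjI notI K)
  assume "K = {}"
  \<comment> \<open>The empty set is the least compact saturated set on both sides, so it maps to itself.\<close>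
  obtain A where A: "compact_saturated L A" "f A = {}"
    using compact_saturated_preimage M.compact_saturated_empty by blast
  have "f K \<subseteq> {}"
    using image_subset_iff[OF K A(1)] \<open>K = {}\<close> A(2) by simp
  then show False using irr by (simp add: k_irreducible_def)
next
  assume "\<exists>A B. compact_saturated L A \<and> compact_saturated L B \<and> A \<subset> K \<and> B \<subset> K \<and> K = A \<union> B"
  then obtain A B where AB: "compact_saturated L A" "compact_saturated L B"
      "A \<subset> K" "B \<subset> K" "K = A \<union> B"
    by blast
  have "f A \<subset> f K" "f B \<subset> f K"
    using image_psubset_iff[OF AB(1) K] image_psubset_iff[OF AB(2) K] AB(3,4) by simp_all
  moreover have "f K = f A \<union> f B"
    using image_Un[OF AB(1,2)] unfolding AB(5) .
  moreover have "compact_saturated M (f A)" "compact_saturated M (f B)"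
    using compact_saturated_image AB(1,2) by simp_all
  ultimately show False
    using irr unfolding k_irreducible_def by meson
qed

text \<open>The preimage of \<open>\<up>y\<close> is \<open>k\<close>-irreducible because \<open>\<up>y\<close> is, and co-sobriety gives it a
  generator.\<close>

lemma principal_preimage:
  assumes "co_sober L" and y: "y \<in> carrier M"
  obtains x where "x \<in> carrier L" "f (up_closure L {x}) = up_closure M {y}"
proof -
  obtain K where K: "compact_saturated L K" "f K = up_closure M {y}"
    using compact_saturated_preimage M.compact_saturated_up_closure_singleton[OF y] by blast
  then have "k_irreducible L K"
    using k_irreducible_reflected M.k_irreducible_up_closure_singleton[OF y] by simp
  with assms(1) that K(2) show ?thesis unfolding co_sober_def by blast
qed

text \<open>Removing \<open>d\<close> from \<open>\<up>d\<close> leaves the largest compact saturated proper subset of \<open>\<up>d\<close>. For a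
  point \<open>y\<close> of \<open>f (\<up>d)\<close> outside the image of that subset, \<open>\<up>y\<close> cannot be a proper subset of
  \<open>f (\<up>d)\<close>.\<close>

lemma principal_image_of_punctured_compact:
  assumes d: "d \<in> carrier L"
    and cpt: "compactin (scott_topology L) (up_closure L {d} - {d})"
  obtains y where "y \<in> carrier M" "f (up_closure L {d}) = up_closure M {y}"
proof -
  let ?K = "up_closure L {d}" and ?K' = "up_closure L {d} - {d}"
  have K: "compact_saturated L ?K"
    using L.compact_saturated_up_closure_singleton[OF d] .
  have K': "compact_saturated L ?K'"
    using L.compact_saturated_punctured_up_closure[OF d cpt] .
  have "?K' \<subset> ?K" using L.self_mem_up_closure[OF d] by blast
  then have "f ?K' \<subset> f ?K" using image_psubset_iff[OF K' K] by simp
  then obtain y where y: "y \<in> f ?K" "y \<notin> f ?K'" by blast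
  have up: "upper_set M (f ?K)"
    using compact_saturated_image[OF K] by (simp add: compact_saturated_def)
  then have yM: "y \<in> carrier M"
    using y(1) by (auto simp: upper_set_def)
  obtain A where A: "compact_saturated L A" "f A = up_closure M {y}"
    using compact_saturated_preimage M.compact_saturated_up_closure_singleton[OF yM] by blast
  have "f A \<subseteq> f ?K"
    using A(2) M.up_closure_singleton_subset_upper[OF up y(1)] by simp
  then have "A \<subseteq> ?K" using image_subset_iff[OF A(1) K] by simp
  moreover have "\<not> A \<subseteq> ?K'"
    using image_subset_iff[OF A(1) K'] A(2) y(2) M.self_mem_up_closure[OF yM] by blast
  ultimately have "d \<in> A" by blast
  then have "A = ?K"
    using \<open>A \<subseteq> ?K\<close> L.up_closure_singleton_subset_upper A(1)
    unfolding compact_saturated_def by blast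
  with A(2) that yM show ?thesis by simp
qed

lemma generator_le_iff:
  assumes x: "x \<in> carrier L" and x': "x' \<in> carrier L"
    and y: "y \<in> carrier M" and y': "y' \<in> carrier M"
    and fx: "f (up_closure L {x}) = up_closure M {y}"
    and fx': "f (up_closure L {x'}) = up_closure M {y'}"
  shows "y \<sqsubseteq>\<^bsub>M\<^esub> y' \<longleftrightarrow> x \<sqsubseteq>\<^bsub>L\<^esub> x'"
proof -
  have "y \<sqsubseteq>\<^bsub>M\<^esub> y' \<longleftrightarrow> f (up_closure L {x'}) \<subseteq> f (up_closure L {x})"
    unfolding fx fx' by (rule M.up_closure_singleton_subset_iff[OF y' y, symmetric])
  also have "\<dots> \<longleftrightarrow> up_closure L {x'} \<subseteq> up_closure L {x}"
    by (intro image_subset_iff L.compact_saturated_up_closure_singleton x x')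
  also have "\<dots> \<longleftrightarrow> x \<sqsubseteq>\<^bsub>L\<^esub> x'"
    by (rule L.up_closure_singleton_subset_iff[OF x' x])
  finally show ?thesis .
qed

text \<open>The generators \<open>e d\<close> of the sets \<open>f (\<up>d)\<close> have a supremum \<open>y\<close>, and \<open>\<up>y\<close> is the intersection of
  the sets \<open>\<up>(e d)\<close>, hence contains \<open>f (\<up>x)\<close>. Co-sobriety enters for the other inclusion: it
  provides an \<open>x'\<close> with \<open>f (\<up>x') = \<up>y\<close>, which is an upper bound of \<open>D\<close> and hence above \<open>x\<close>.\<close>

lemma principal_image_of_directed_sup:
  assumes "co_sober L" and "dcpo M"
    and D: "directed L D" and x: "is_lub L x D"
    and principal: "\<And>d. d \<in> D \<Longrightarrow> \<exists>y\<in>carrier M. f (up_closure L {d}) = up_closure M {y}"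
  obtains y where "y \<in> carrier M" "f (up_closure L {x}) = up_closure M {y}"
proof -
  have DL: "D \<subseteq> carrier L" using D by (simp add: directed_def)
  have xL: "x \<in> carrier L" using x by (auto simp: least_def Upper_def)
  obtain e where e: "\<And>d. d \<in> D \<Longrightarrow> e d \<in> carrier M"
      "\<And>d. d \<in> D \<Longrightarrow> f (up_closure L {d}) = up_closure M {e d}"
    using principal by metis
  have e_le_iff: "e a \<sqsubseteq>\<^bsub>M\<^esub> e b \<longleftrightarrow> a \<sqsubseteq>\<^bsub>L\<^esub> b" if a: "a \<in> D" and b: "b \<in> D" for a b
    by (rule generator_le_iff[OF subsetD[OF DL a] subsetD[OF DL b] e(1)[OF a] e(1)[OF b]
          e(2)[OF a] e(2)[OF b]])
  have "directed M (e ` D)"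
    unfolding directed_def
  proof (intro conjI allI impI)
    show "e ` D \<subseteq> carrier M" using e(1) by blast
    fix F assume "finite F \<and> F \<subseteq> e ` D"
    then obtain G where G: "G \<subseteq> D" "finite G" "F = e ` G"
      using finite_subset_image by metis
    then obtain u where u: "u \<in> D" "u \<in> Upper L G"
      using D unfolding directed_def by blast
    then have "\<forall>a\<in>G. a \<sqsubseteq>\<^bsub>L\<^esub> u" using G(1) DL by (auto simp: Upper_def)
    then have "e u \<in> Upper M F"
      using G u(1) e(1) e_le_iff by (auto simp: Upper_def)
    then show "\<exists>u\<in>e ` D. u \<in> Upper M F" using u(1) by blast
  qed
  then obtain y where y: "is_lub M y (e ` D)"
    using dcpo.directed_has_sup[OF \<open>dcpo M\<close>] by blast
  have yM: "y \<in> carrier M" using y by (auto simp: least_def Upper_def)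
  have eD: "e ` D \<subseteq> carrier M" using e(1) by blast
  obtain x' where x': "x' \<in> carrier L" "f (up_closure L {x'}) = up_closure M {y}"
    using principal_preimage[OF \<open>co_sober L\<close> yM] .
  note cs = L.compact_saturated_up_closure_singleton
  have below: "up_closure M {y} \<subseteq> f (up_closure L {x})"
  proof -
    have "d \<sqsubseteq>\<^bsub>L\<^esub> x'" if d: "d \<in> D" for d
    proof -
      have "e d \<sqsubseteq>\<^bsub>M\<^esub> y" using M.lub_le_iff[OF y eD yM] M.le_refl[OF yM] d by blast
      then show ?thesis
        using generator_le_iff[OF subsetD[OF DL d] x'(1) e(1)[OF d] yM e(2)[OF d] x'(2)] by simp
    qed
    then have "x \<sqsubseteq>\<^bsub>L\<^esub> x'" using L.lub_le_iff[OF x DL x'(1)] by blast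
    then have "up_closure L {x'} \<subseteq> up_closure L {x}"
      using L.up_closure_singleton_subset_iff x'(1) xL by simp
    then show ?thesis using image_subset_iff[OF cs cs] x' xL by blast
  qed
  have above: "f (up_closure L {x}) \<subseteq> up_closure M {y}"
  proof
    fix z assume z: "z \<in> f (up_closure L {x})"
    then have zM: "z \<in> carrier M"
      using compact_saturated_image[OF cs[OF xL]]
      by (auto simp: compact_saturated_def upper_set_def)
    have "e d \<sqsubseteq>\<^bsub>M\<^esub> z" if "d \<in> D" for d
    proof -
      have dL: "d \<in> carrier L" using that DL by blast
      have "d \<sqsubseteq>\<^bsub>L\<^esub> x" using L.lub_le_iff[OF x DL xL] L.le_refl[OF xL] that by blast
      then have "up_closure L {x} \<subseteq> up_closure L {d}"
        using L.up_closure_singleton_subset_iff[OF xL dL] by simp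
      then have "f (up_closure L {x}) \<subseteq> up_closure M {e d}"
        using image_subset_iff[OF cs[OF xL] cs[OF dL]] e(2)[OF that] by simp
      then show ?thesis using z by (auto simp: mem_up_closure_singleton)
    qed
    then show "z \<in> up_closure M {y}"
      using M.lub_le_iff[OF y eD zM] zM by (simp add: mem_up_closure_singleton)
  qed
  show ?thesis using that yM above below by blast
qed

text \<open>A bijection between all principal filters of \<open>L\<close> and all those of \<open>M\<close> that respects
  inclusion matches their generators.\<close>

lemma order_isomorphic_if_principal_images:
  assumes image: "\<And>x. x \<in> carrier L \<Longrightarrow> \<exists>y\<in>carrier M. f (up_closure L {x}) = up_closure M {y}"
    and preimage: "\<And>y. y \<in> carrier M \<Longrightarrow> \<exists>x\<in>carrier L. f (up_closure L {x}) = up_closure M {y}"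
  shows "order_isomorphic L M"
proof -
  obtain h where h: "\<And>x. x \<in> carrier L \<Longrightarrow> h x \<in> carrier M"
      "\<And>x. x \<in> carrier L \<Longrightarrow> f (up_closure L {x}) = up_closure M {h x}"
    using image by metis
  have h_le_iff: "h a \<sqsubseteq>\<^bsub>M\<^esub> h b \<longleftrightarrow> a \<sqsubseteq>\<^bsub>L\<^esub> b" if a: "a \<in> carrier L" and b: "b \<in> carrier L" for a b
    by (rule generator_le_iff[OF a b h(1)[OF a] h(1)[OF b] h(2)[OF a] h(2)[OF b]])
  have "inj_on h (carrier L)"
  proof (rule inj_onI)
    fix a b assume ab: "a \<in> carrier L" "b \<in> carrier L" "h a = h b"
    then have "a \<sqsubseteq>\<^bsub>L\<^esub> b" "b \<sqsubseteq>\<^bsub>L\<^esub> a"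
      using h_le_iff h(1) M.le_refl by metis+
    then show "a = b" using ab(1,2) by (rule L.le_antisym)
  qed
  moreover have "h ` carrier L = carrier M"
  proof
    show "h ` carrier L \<subseteq> carrier M" using h(1) by blast
    show "carrier M \<subseteq> h ` carrier L"
    proof
      fix y assume y: "y \<in> carrier M"
      then obtain x where x: "x \<in> carrier L" "f (up_closure L {x}) = up_closure M {y}"
        using preimage by blast
      then have "y \<sqsubseteq>\<^bsub>M\<^esub> h x" "h x \<sqsubseteq>\<^bsub>M\<^esub> y"
        using generator_le_iff[OF x(1) x(1) y h(1)[OF x(1)] x(2) h(2)[OF x(1)]]
          generator_le_iff[OF x(1) x(1) h(1)[OF x(1)] y h(2)[OF x(1)] x(2)] L.le_refl[OF x(1)]
        by simp_all
      then have "y = h x" using y h(1)[OF x(1)] by (rule M.le_antisym)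
      with x(1) show "y \<in> h ` carrier L" by blast
    qed
  qed
  moreover have "order_emb L M h"
    unfolding order_emb_def
    using h_le_iff L.weak_partial_order_axioms M.weak_partial_order_axioms by blast
  ultimately show ?thesis
    unfolding order_isomorphic_def bij_betw_def by blast
qed

end

lemma Q_isomorphism_of_order_isomorphic:
  assumes "partial_order L" "partial_order M" "order_isomorphic (Q_poset L) (Q_poset M)"
  obtains f where "Q_isomorphism L M f"
proof -
  obtain f where emb: "order_emb (Q_poset L) (Q_poset M) f"
      and bij: "bij_betw f {K. compact_saturated L K} {K. compact_saturated M K}"
    using assms(3) by (auto simp: order_isomorphic_def Q_poset_def)
  have "f A \<subseteq> f B \<longleftrightarrow> A \<subseteq> B" if "compact_saturated L A" "compact_saturated L B" for A B
    using emb that by (simp add: order_emb_def Q_poset_def)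
  with assms(1,2) bij have "Q_isomorphism L M f"
    unfolding Q_isomorphism_def Q_isomorphism_axioms_def by blast
  then show ?thesis by (rule that)
qed

section \<open>Uniqueness\<close>

theorem theorem3p15:
  fixes L :: "('a, 'c) gorder_scheme" and M :: "('b, 'd) gorder_scheme"
  assumes "dcpo L"
    and "co_sober L"
    and "\<And>x. x \<in> carrier L \<Longrightarrow>
           \<exists>D. directed L D \<and> is_lub L x D \<and>
               (\<forall>d\<in>D. compactin (scott_topology L) (up_closure L {d} - {d}))"
    and "dcpo M"
    and "order_isomorphic (Q_poset L) (Q_poset M)"
  shows "order_isomorphic L M"
proof -
  obtain f where "Q_isomorphism L M f"
    using Q_isomorphism_of_order_isomorphic assms(1,4,5) dcpo.axioms(1) by metis
  then interpret Q_isomorphism L M f .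
  show ?thesis
  proof (rule order_isomorphic_if_principal_images)
    fix x assume "x \<in> carrier L"
    then obtain D where D: "directed L D" "is_lub L x D"
        and cpt: "\<And>d. d \<in> D \<Longrightarrow> compactin (scott_topology L) (up_closure L {d} - {d})"
      using assms(3) by blast
    have "\<exists>y\<in>carrier M. f (up_closure L {d}) = up_closure M {y}" if "d \<in> D" for d
    proof -
      have "d \<in> carrier L" using that D(1) by (auto simp: directed_def)
      then show ?thesis
        using principal_image_of_punctured_compact cpt[OF that] by metis
    qed
    then show "\<exists>y\<in>carrier M. f (up_closure L {x}) = up_closure M {y}"
      using principal_image_of_directed_sup[OF assms(2,4) D] by metis
  next
    fix y assume "y \<in> carrier M"
    then show "\<exists>x\<in>carrier L. f (up_closure L {x}) = up_closure M {y}"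
      using principal_preimage[OF assms(2)] by metis
  qed
qed

end
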